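(* Let $r \in \mathbb{N}$ with $r \geq 2$ and let $p \in (0,1)$. Let $N_1$ be the number of samples of an i.i.d. Bernoulli($p$) sequence observed until exactly $r$ successes have occurred, and let $N_2$ be the number of samples of a second i.i.d. Bernoulli($p$) sequence, independent of the first, observed until exactly $r$ failures have occurred. Define $$\hat\phi = -H_{N_1-1} + H_{N_2-1}, \qquad N = N_1+N_2.$$ Then $$\mathrm{E}[\hat\phi] = \log\frac{p}{1-p},$$ $$\mathrm{Var}[\hat\phi] < \frac{r^2-r/4-1/4}{(r-1+p)(r-p)(r-1/2)} - \frac{p(1-p)}{(r-1/2)^2}\left(1-\frac{1}{2r-3}\right) < \frac{1}{r-5/4}\left(1-\frac{7}{(4r-1)^2}\right),$$ $$\mathrm{E}[N] = \frac{r}{p(1-p)}.$$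
   Context: $H_n = 1+1/2+\cdots+1/n$ denotes the $n$-th harmonic number, and $\log$ is the natural logarithm. A Bernoulli($p$) variable takes the value "success" with probability $p$ and "failure" with probability $1-p$. Sample counts include the last success (respectively failure), so $\Pr[N_1=n]=\binom{n-1}{r-1}p^{r}(1-p)^{n-r}$ and $\Pr[N_2=n]=\binom{n-1}{r-1}(1-p)^{r}p^{n-r}$ for $n\ge r$; $N_1$ and $N_2$ are independent. *)

theory Defs
  imports "HOL-Probability.Probability"
begin

text \<open>
  The sequence index starts at 0, so the first \<open>n\<close> samples are those with index \<open>i < n\<close>;
  the count therefore includes the sample that is the \<open>r\<close>-th hit. On the null event that
  the sequence has fewer than \<open>r\<close> hits, the value is an unspecified natural number.
\<close>

definition samples_until :: "nat \<Rightarrow> (nat \<Rightarrow> bool) \<Rightarrow> nat" where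
  "samples_until r s = (LEAST n. card {i. i < n \<and> s i} = r)"

end

theory Submission
  imports Defs "HOL-Real_Asymp.Real_Asymp"
begin

text \<open>
  Conditioning on one Bernoulli trial gives a Pascal-type recursion for the negative binomial weights,
  hence a recursion in \<open>r\<close> for expectations: passing from \<open>r\<close> to \<open>r + 1\<close> changes \<open>E f(N)\<close> by a weighted
  sum of the increments of \<open>f\<close>. Write \<open>K\<^sub>n\<close> for the sum of \<open>1 / k\<^sup>2\<close> over \<open>k \<le> n\<close>. For \<open>H\<^bsub>N - 1\<^esub>\<close> and for
  \<open>(H\<^bsub>N - 1\<^esub>)\<^sup>2 - K\<^bsub>N - 1\<^esub>\<close> the increments collapse to weights of lower order, so their expectations are
  \<open>H\<^bsub>r - 1\<^esub> - ln p\<close> and \<open>(H\<^bsub>r - 1\<^esub> - ln p)\<^sup>2 - K\<^bsub>r - 1\<^esub>\<close>. Thus the variance of \<open>H\<^bsub>N - 1\<^esub>\<close> is the expectation of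
  the sum of \<open>1 / k\<^sup>2\<close> over \<open>r \<le> k < N\<close>. Bounding \<open>1 / k\<^sup>2\<close> by the telescoping difference
  \<open>1 / (k - 1/2) - 1 / (k + 1/2)\<close> and applying Jensen's inequality to \<open>1 / (N - 1/2)\<close> bounds it by
  \<open>r (1 - p) / ((r - 1/2) (r - p/2))\<close>. Adding the same bound for \<open>1 - p\<close> leaves rational inequalities in
  \<open>r\<close> and \<open>w = p (1 - p)\<close>; with \<open>(r - w) / (r\<^sup>2 - r + w)\<close> as intermediate bound they are elementary.
\<close>

section \<open>Negative binomial weights: recursions and summability\<close>

text \<open>
  The probability that the \<open>(r + 1)\<close>-st success occurs at trial number \<open>n + 1\<close>. Both indices are
  shifted by one, so that the paper's \<open>H\<^bsub>N - 1\<^esub>\<close> becomes \<open>harm n\<close> and no truncated subtraction of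
  \<open>r - 1\<close> occurs.
\<close>

definition nb_weight :: "real \<Rightarrow> nat \<Rightarrow> nat \<Rightarrow> real" where
  "nb_weight p r n = real (n choose r) * p ^ Suc r * (1 - p) ^ (n - r)"

definition harm2 :: "nat \<Rightarrow> real" where
  "harm2 n = (\<Sum>k=1..n. 1 / (real k)\<^sup>2)"

lemma harm2_0 [simp]: "harm2 0 = 0"
  by (simp add: harm2_def)

lemma harm2_Suc: "harm2 (Suc n) = harm2 n + 1 / (real n + 1)\<^sup>2"
  by (simp add: harm2_def add.commute)

lemma nb_weight_0: "nb_weight p 0 n = p * (1 - p) ^ n"
  by (simp add: nb_weight_def)

lemma nb_weight_Suc_0: "nb_weight p (Suc r) 0 = 0"
  by (simp add: nb_weight_def)

lemma nb_weight_eq_0: "n < r \<Longrightarrow> nb_weight p r n = 0"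
  by (simp add: nb_weight_def)

lemma nb_weight_nonneg: "0 \<le> p \<Longrightarrow> p \<le> 1 \<Longrightarrow> 0 \<le> nb_weight p r n"
  by (simp add: nb_weight_def)

text \<open>Pascal's rule for \<open>Suc n choose Suc r\<close>, read as conditioning on one
  trial.\<close>

lemma nb_weight_Suc_Suc:
  "nb_weight p (Suc r) (Suc n) = p * nb_weight p r n + (1 - p) * nb_weight p (Suc r) n"
\<comment> \<open>For \<open>r < n\<close> the exponent \<open>n - r\<close> exceeds
  \<open>n - Suc r\<close> by one and supplies the factor \<open>1 - p\<close>. Otherwise truncated
  subtraction breaks this, but then \<open>n choose Suc r\<close> is zero.\<close>
proof (cases "r < n")
  case True
  then have e: "n - r = Suc (n - Suc r)"
    by simp
  show ?thesis
    unfolding nb_weight_def diff_Suc_Suc binomial_Suc_Suc of_nat_add e by (simp add: algebra_simps)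
next
  case False
  then show ?thesis
    by (cases n r rule: linorder_cases) (simp_all add: nb_weight_def binomial_eq_0)
qed

text \<open>The absorption identity for binomial coefficients. It turns the increment
  \<open>1 / (n + 1)\<close> of a harmonic number into a constant factor while lowering the index of
  the weight.\<close>

lemma nb_weight_Suc_Suc_div:
  "nb_weight p (Suc r) (Suc n) / (real n + 1) = p / (real r + 1) * nb_weight p r n"
proof -
  have "nb_weight p (Suc r) (Suc n) * (real r + 1)
      = real (Suc r) * real (Suc n choose Suc r) * (p ^ Suc (Suc r) * (1 - p) ^ (n - r))"
    by (simp add: nb_weight_def algebra_simps del: binomial_Suc_Suc)
  also have "real (Suc r) * real (Suc n choose Suc r) = real (Suc n) * real (n choose r)"
    by (metis Suc_times_binomial of_nat_mult)
  also have "\<dots> * (p ^ Suc (Suc r) * (1 - p) ^ (n - r)) = p * nb_weight p r n * (real n + 1)"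
    by (simp add: nb_weight_def algebra_simps)
  finally show ?thesis
    by (simp add: field_simps)
qed

text \<open>Since \<open>n choose r\<close> is at most \<open>n ^ r\<close>, the terms are a
  polynomial times \<open>q ^ n\<close>. Any ratio strictly between \<open>q\<close> and 1 absorbs
  the polynomial; the midpoint \<open>(1 + q) / 2 = 1 - p / 2\<close> is used.\<close>

lemma summable_nb_weight_power:
  assumes "0 < p" "p < 1"
  shows "summable (\<lambda>n. nb_weight p r n * (real n + 1) ^ k)"
proof (rule summable_comparison_test_bigo)
  have "p / 2 > 0" "1 - p / 2 < 1" "1 - p/2 > 0" using assms by auto
  then show "summable (\<lambda>n. norm ((1 - p / 2) ^ n))"
    by (simp add: summable_geometric)
  define q where "q = 1 - p"
  have q: "0 < q" "q < 1" using assms by (auto simp: q_def)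
  have "(\<lambda>n. nb_weight p r n * (real n + 1) ^ k) \<in> O(\<lambda>n. real n ^ r * (real n + 1) ^ k * q ^ n)"
  proof (rule bigoI[of _ "p ^ Suc r / q ^ r"], rule always_eventually, rule allI)
    fix n
    show "norm (nb_weight p r n * (real n + 1) ^ k)
        \<le> p ^ Suc r / q ^ r * norm (real n ^ r * (real n + 1) ^ k * q ^ n)"
    proof (cases "r \<le> n")
      case True
      have "real (n choose r) \<le> real n ^ r"
        using binomial_le_pow[OF True] by (metis of_nat_le_iff of_nat_power)
      then have "real (n choose r) * (p ^ Suc r * q ^ (n - r) * (real n + 1) ^ k)
          \<le> real n ^ r * (p ^ Suc r * q ^ (n - r) * (real n + 1) ^ k)"
        using q assms by (intro mult_right_mono) auto
      moreover have "q ^ (n - r) = q ^ n / q ^ r"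
        using True q by (simp add: power_diff)
      ultimately show ?thesis
        using q assms by (simp add: nb_weight_def q_def [symmetric] algebra_simps)
    next
      case False
      then show ?thesis using q assms by (simp add: nb_weight_eq_0)
    qed
  qed
  also have "(\<lambda>n. real n ^ r * (real n + 1) ^ k * q ^ n) \<in> O(\<lambda>n. ((1 + q) / 2) ^ n)"
    using q by real_asymp
  finally show "(\<lambda>n. nb_weight p r n * (real n + 1) ^ k) \<in> O(\<lambda>n. (1 - p / 2) ^ n)"
    by (simp add: q_def field_simps)
qed

lemma summable_nb_weight:
  assumes "0 < p" "p < 1" and "\<And>n. \<bar>f n\<bar> \<le> (real n + 1) ^ k"
  shows "summable (\<lambda>n. \<bar>nb_weight p r n * f n\<bar>)"
    and "summable (\<lambda>n. nb_weight p r n * f n)"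
proof -
  show "summable (\<lambda>n. \<bar>nb_weight p r n * f n\<bar>)"
  proof (rule summable_comparison_test[OF _ summable_nb_weight_power[OF assms(1,2), of r k]], intro exI allI impI)
    fix n
    show "norm \<bar>nb_weight p r n * f n\<bar> \<le> nb_weight p r n * (real n + 1) ^ k"
      using assms nb_weight_nonneg[of p r n] by (simp add: abs_mult mult_left_mono)
  qed
  then show "summable (\<lambda>n. nb_weight p r n * f n)"
    by (rule summable_rabs_cancel)
qed

section \<open>Recursion in the number of hits; total mass and mean\<close>

text \<open>Summation by parts: the geometric weights shrink by \<open>1 - p\<close> per index, so
  subtracting \<open>1 - p\<close> times the series from its shift leaves \<open>p * D\<close>, an
  equation that determines the sum \<open>s\<close>.\<close>

lemma nb_weight_sums_0:
  assumes "0 < p" "p < 1"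
    and D: "(\<lambda>n. (1 - p) ^ Suc n * (f (Suc n) - f n)) sums D"
    and S: "summable (\<lambda>n. nb_weight p 0 n * f n)"
  shows "(\<lambda>n. nb_weight p 0 n * f n) sums (f 0 + D)"
proof -
  obtain s where s: "(\<lambda>n. nb_weight p 0 n * f n) sums s"
    using S by blast
  have "(\<lambda>n. nb_weight p 0 (Suc n) * f (Suc n)) sums (s - p * f 0)"
    using s by (subst sums_Suc_iff) (simp add: nb_weight_0)
  from sums_diff[OF this sums_mult[OF s, of "1 - p"]]
  have "(\<lambda>n. p * ((1 - p) ^ Suc n * (f (Suc n) - f n))) sums (s - p * f 0 - (1 - p) * s)"
    by (simp add: nb_weight_0 algebra_simps)
  with sums_mult[OF D, of p] have "s - p * f 0 - (1 - p) * s = p * D"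
    using sums_unique2 by blast
  then have "p * s = p * (f 0 + D)" by (simp add: algebra_simps)
  with s assms show ?thesis by simp
qed

text \<open>The Pascal recursion summed against \<open>f\<close> gives
  \<open>s = p * A + (1 - p) * s + D\<close>. Summability is assumed so that \<open>s\<close> exists
  and this can be solved for it.\<close>

lemma nb_weight_sums_Suc:
  assumes "0 < p" "p < 1"
    and A: "(\<lambda>n. nb_weight p r n * f n) sums A"
    and D: "(\<lambda>n. nb_weight p (Suc r) (Suc n) * (f (Suc n) - f n)) sums D"
    and S: "summable (\<lambda>n. nb_weight p (Suc r) n * f n)"
  shows "(\<lambda>n. nb_weight p (Suc r) n * f n) sums (A + D / p)"
proof -
  obtain s where s: "(\<lambda>n. nb_weight p (Suc r) n * f n) sums s"
    using S by blast
  have s': "(\<lambda>n. nb_weight p (Suc r) (Suc n) * f (Suc n)) sums s"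
    using s by (subst sums_Suc_iff) (simp add: nb_weight_Suc_0)
  have "(\<lambda>n. nb_weight p (Suc r) (Suc n) * f n) sums (p * A + (1 - p) * s)"
    using sums_add[OF sums_mult[OF A, of p] sums_mult[OF s, of "1 - p"]]
    by (simp add: nb_weight_Suc_Suc algebra_simps)
  from sums_diff[OF s' this]
  have "(\<lambda>n. nb_weight p (Suc r) (Suc n) * (f (Suc n) - f n)) sums (s - (p * A + (1 - p) * s))"
    by (simp add: algebra_simps)
  with D have "s - (p * A + (1 - p) * s) = D"
    using sums_unique2 by blast
  then have "s = A + D / p" using assms(1) by (simp add: field_simps)
  with s show ?thesis by simp
qed

lemma nb_weight_sums_1:
  assumes p: "0 < p" "p < 1"
  shows "nb_weight p r sums 1"
proof -
  have S: "summable (\<lambda>n. nb_weight p r n * 1)" for r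
    by (rule summable_nb_weight(2)[OF p, of _ 0]) simp
  have "(\<lambda>n. nb_weight p r n * 1) sums 1"
  proof (induction r)
    case 0
    show ?case using nb_weight_sums_0[OF p _ S, of 0] by simp
  next
    case (Suc r)
    show ?case using nb_weight_sums_Suc[OF p Suc _ S, of 0] by simp
  qed
  then show ?thesis by simp
qed

lemma nb_weight_sums_real:
  assumes p: "0 < p" "p < 1"
  shows "(\<lambda>n. nb_weight p r n * (real n + 1)) sums ((real r + 1) / p)"
proof (induction r)
  have S: "summable (\<lambda>n. nb_weight p r n * (real n + 1))" for r
    by (rule summable_nb_weight(2)[OF p, of _ 1]) simp
  {
    case 0
    have "(\<lambda>n. (1 - p) ^ Suc n * (real (Suc n) + 1 - (real n + 1))) sums ((1 - p) * (1 / (1 - (1 - p))))"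
      using sums_mult[OF geometric_sums[of "1 - p"], of "1 - p"] p by simp
    from nb_weight_sums_0[OF p this S] show ?case using p by (simp add: field_simps)
  next
    case (Suc r)
    have "(\<lambda>n. nb_weight p (Suc r) (Suc n)) sums 1"
      using nb_weight_sums_1[OF p, of "Suc r"] sums_Suc_iff[of "nb_weight p (Suc r)" 1]
      by (simp add: nb_weight_Suc_0)
    then have "(\<lambda>n. nb_weight p (Suc r) (Suc n) * (real (Suc n) + 1 - (real n + 1))) sums 1"
      by simp
    from nb_weight_sums_Suc[OF p Suc this S] show ?case using p by (simp add: field_simps)
  }
qed

section \<open>Harmonic sums and the logarithm series\<close>

lemma harm_Suc_real: "harm (Suc n) = harm n + 1 / (real n + 1)"
  by (simp add: harm_Suc divide_inverse add.commute)

lemma harm_le_real: "harm n \<le> real n"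
proof (induction n)
  case (Suc n)
  have "1 / (real n + 1) \<le> 1" by simp
  with Suc show ?case unfolding harm_Suc_real of_nat_Suc by linarith
qed (simp add: harm_def)

lemma harm2_nonneg: "0 \<le> harm2 n"
  by (simp add: harm2_def sum_nonneg)

text \<open>Makes \<open>(harm n)\<^sup>2 - harm2 n\<close> nonnegative, hence dominated by
  \<open>(harm n)\<^sup>2\<close>, which settles its summability.\<close>

lemma harm2_le_harm_squared: "harm2 n \<le> (harm n)\<^sup>2"
proof (induction n)
  case (Suc n)
  have "(harm (Suc n))\<^sup>2 = (harm n)\<^sup>2 + 2 * harm n / (real n + 1) + 1 / (real n + 1)\<^sup>2"
    by (simp add: harm_Suc_real power2_eq_square algebra_simps)
  moreover have "2 * harm n / (real n + 1) \<ge> 0"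
    by (simp add: harm_nonneg)
  ultimately show ?case using Suc by (simp add: harm2_Suc)
qed simp

lemma harm_squared_le: "(harm n)\<^sup>2 \<le> (real n + 1)\<^sup>2"
  using harm_le_real[of n] by (intro power_mono) (auto simp: harm_nonneg)

lemma summable_nb_weight_harm:
  assumes p: "0 < p" "p < 1"
  shows "summable (\<lambda>n. \<bar>nb_weight p r n * harm n\<bar>)"
    and "summable (\<lambda>n. \<bar>nb_weight p r n * (harm n)\<^sup>2\<bar>)"
    and "summable (\<lambda>n. \<bar>nb_weight p r n * ((harm n)\<^sup>2 - harm2 n)\<bar>)"
proof -
  show "summable (\<lambda>n. \<bar>nb_weight p r n * harm n\<bar>)"
  proof (rule summable_nb_weight(1)[OF p, of _ 1])
    show "\<bar>harm n\<bar> \<le> (real n + 1) ^ 1" for n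
      using harm_le_real[of n] harm_nonneg[of n, where 'a = real] by simp
  qed
  show "summable (\<lambda>n. \<bar>nb_weight p r n * (harm n)\<^sup>2\<bar>)"
    by (rule summable_nb_weight(1)[OF p, of _ 2]) (use harm_squared_le in simp)
  show "summable (\<lambda>n. \<bar>nb_weight p r n * ((harm n)\<^sup>2 - harm2 n)\<bar>)"
  proof (rule summable_nb_weight(1)[OF p, of _ 2])
    show "\<bar>(harm n)\<^sup>2 - harm2 n\<bar> \<le> (real n + 1)\<^sup>2" for n
      using harm_squared_le[of n] harm2_le_harm_squared[of n] harm2_nonneg[of n] by simp
  qed
qed

text \<open>The term at \<open>n = 0\<close> is a division by zero and so counts as 0.\<close>

lemma log_series_sums:
  assumes "\<bar>x\<bar> < (1 :: real)"
  shows "(\<lambda>n. x ^ n / real n) sums - ln (1 - x)"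
proof -
  have "(\<lambda>n. - ((- (- x)) ^ n) / real n) sums ln (1 + - x)"
    using assms by (intro ln_series') auto
  from sums_minus[OF this] show ?thesis by simp
qed

text \<open>For \<open>r = 0\<close> the increments form the logarithm series at
  \<open>1 - p\<close>. In the induction step absorption reduces them to a multiple of the total
  mass 1, which adds \<open>1 / (r + 1)\<close>.\<close>

lemma nb_weight_sums_harm:
  assumes p: "0 < p" "p < 1"
  shows "(\<lambda>n. nb_weight p r n * harm n) sums (harm r - ln p)"
proof (induction r)
  have S: "summable (\<lambda>n. nb_weight p r n * harm n)" for r
    by (rule summable_rabs_cancel[OF summable_nb_weight_harm(1)[OF p]])
  {
    case 0
    have "(\<lambda>n. (1 - p) ^ Suc n / real (Suc n)) sums (- ln p)"
      using log_series_sums[of "1 - p"] p by (subst sums_Suc_iff) simp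
    then have "(\<lambda>n. (1 - p) ^ Suc n * (harm (Suc n) - harm n)) sums (- ln p)"
      by (simp add: harm_Suc divide_inverse)
    from nb_weight_sums_0[OF p this S] show ?case by (simp add: harm_def)
  next
    case (Suc r)
    have "(\<lambda>n. nb_weight p (Suc r) (Suc n) / (real n + 1)) sums (p / (real r + 1))"
      using sums_mult[OF nb_weight_sums_1[OF p, of r], of "p / (real r + 1)"]
      unfolding nb_weight_Suc_Suc_div by simp
    then have "(\<lambda>n. nb_weight p (Suc r) (Suc n) * (harm (Suc n) - harm n)) sums (p / (real r + 1))"
      by (simp add: harm_Suc divide_inverse add.commute)
    note nb_weight_sums_Suc[OF p Suc this S]
    also have "p / (real r + 1) / p = 1 / (real r + 1)"
      using p by simp
    finally show ?case
      by (simp add: harm_Suc_real algebra_simps)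
  }
qed

text \<open>The summands for \<open>i = 0\<close> and \<open>i = Suc n\<close> vanish because \<open>1 / 0 = 0\<close>.\<close>

lemma sum_inverse_mult_reflect:
  "(\<Sum>i\<le>Suc n. 1 / real i * (1 / real (Suc n - i))) = 2 * harm n / (real n + 1)"
proof -
  have "(\<Sum>i\<le>Suc n. 1 / real i * (1 / real (Suc n - i))) = (\<Sum>i\<in>{1..n}. 1 / real i * (1 / real (Suc n - i)))"
    by (rule sum.mono_neutral_right) (auto simp: not_le less_Suc_eq_le)
  \<comment> \<open>Partial fractions, the two denominators having the constant sum
    \<open>n + 1\<close>.\<close>
  also have "\<dots> = (\<Sum>i\<in>{1..n}. (1 / real i + 1 / real (Suc n - i)) / (real n + 1))"
  proof (rule sum.cong)
    fix i assume "i \<in> {1..n}"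
    then have "real i > 0" "real (Suc n - i) > 0" "real n + 1 = real (Suc n - i) + real i"
      by (auto simp: of_nat_diff)
    moreover have "1 / x * (1 / y) = (1 / x + 1 / y) / (y + x)" if "x > 0" "y > 0" for x y :: real
    proof -
      have "1 / x + 1 / y = (y + x) / (x * y)" "y + x > 0"
        using that by (auto simp: field_simps)
      then show ?thesis by simp
    qed
    ultimately show "1 / real i * (1 / real (Suc n - i)) = (1 / real i + 1 / real (Suc n - i)) / (real n + 1)"
      by metis
  qed simp
  also have "\<dots> = ((\<Sum>i\<in>{1..n}. 1 / real i) + (\<Sum>i\<in>{1..n}. 1 / real (Suc n - i))) / (real n + 1)"
    by (simp only: sum.distrib sum_divide_distrib [symmetric])
  also have "(\<Sum>i\<in>{1..n}. 1 / real (Suc n - i)) = (\<Sum>i\<in>{1..n}. 1 / real i)"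
    using sum.atLeastAtMost_rev[of "\<lambda>i. 1 / real i" 1 n] by simp
  finally show ?thesis
    by (simp add: harm_def divide_inverse)
qed

text \<open>Cauchy product of the logarithm series with itself; the reflected sum above gives its
  coefficients.\<close>

lemma log_series_squared_sums:
  assumes "\<bar>x\<bar> < (1 :: real)"
  shows "(\<lambda>n. x ^ Suc n * (2 * harm n / (real n + 1))) sums (ln (1 - x))\<^sup>2"
proof -
  have "summable (\<lambda>n. norm (x ^ n / real n))"
    using log_series_sums[of "\<bar>x\<bar>"] assms
    by (auto simp: sums_iff power_abs abs_divide)
  from Cauchy_product_sums[OF this this]
  have "(\<lambda>k. \<Sum>i\<le>k. x ^ i / real i * (x ^ (k - i) / real (k - i))) sums (ln (1 - x))\<^sup>2"
    using sums_unique[OF log_series_sums[OF assms], symmetric] by (simp add: power2_eq_square)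
  also have "(\<lambda>k. \<Sum>i\<le>k. x ^ i / real i * (x ^ (k - i) / real (k - i)))
      = (\<lambda>k. x ^ k * (\<Sum>i\<le>k. 1 / real i * (1 / real (k - i))))"
    by (auto simp: sum_distrib_left power_add [symmetric] intro!: sum.cong)
  finally have "(\<lambda>k. x ^ k * (\<Sum>i\<le>k. 1 / real i * (1 / real (k - i)))) sums (ln (1 - x))\<^sup>2" .
  then show ?thesis
    unfolding sum_inverse_mult_reflect [symmetric] by (subst sums_Suc_iff) simp
qed

text \<open>Subtracting \<open>harm2\<close> cancels the \<open>1 / (n + 1)\<^sup>2\<close> in the
  increment of the square. What remains is the coefficient of the squared logarithm for
  \<open>r = 0\<close>, and otherwise reduces by absorption to the mean of
  \<open>harm\<close>.\<close>

lemma nb_weight_sums_harm_squared: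
  assumes p: "0 < p" "p < 1"
  shows "(\<lambda>n. nb_weight p r n * ((harm n)\<^sup>2 - harm2 n)) sums ((harm r - ln p)\<^sup>2 - harm2 r)"
proof (induction r)
  have S: "summable (\<lambda>n. nb_weight p r n * ((harm n)\<^sup>2 - harm2 n))" for r
    by (rule summable_rabs_cancel[OF summable_nb_weight_harm(3)[OF p]])
  have diff: "((harm (Suc n))\<^sup>2 - harm2 (Suc n)) - ((harm n)\<^sup>2 - harm2 n) = 2 * harm n / (real n + 1)" for n
    by (simp add: harm_Suc_real harm2_Suc power2_eq_square algebra_simps)
  {
    case 0
    have "(\<lambda>n. (1 - p) ^ Suc n * (((harm (Suc n))\<^sup>2 - harm2 (Suc n)) - ((harm n)\<^sup>2 - harm2 n))) sums (ln p)\<^sup>2"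
      using log_series_squared_sums[of "1 - p"] p by (simp only: diff) simp
    from nb_weight_sums_0[OF p this S] show ?case by (simp add: harm_def)
  next
    case (Suc r)
    have *: "nb_weight p (Suc r) (Suc n) * (2 * harm n / (real n + 1))
        = 2 * p / (real r + 1) * (nb_weight p r n * harm n)" for n
      using nb_weight_Suc_Suc_div[of p r n] by (simp add: field_simps)
    have "(\<lambda>n. nb_weight p (Suc r) (Suc n) * (((harm (Suc n))\<^sup>2 - harm2 (Suc n)) - ((harm n)\<^sup>2 - harm2 n)))
        sums (2 * p / (real r + 1) * (harm r - ln p))"
      unfolding diff * by (rule sums_mult[OF nb_weight_sums_harm[OF p]])
    note nb_weight_sums_Suc[OF p Suc this S]
    also have "2 * p / (real r + 1) * (harm r - ln p) / p = 2 / (real r + 1) * (harm r - ln p)"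
      using p by simp
    also have "(harm r - ln p)\<^sup>2 - harm2 r + 2 / (real r + 1) * (harm r - ln p)
        = (harm (Suc r) - ln p)\<^sup>2 - harm2 (Suc r)"
      by (simp add: harm_Suc_real harm2_Suc power2_eq_square algebra_simps diff_divide_distrib)
    finally show ?case .
  }
qed

section \<open>Variance bound for a single count\<close>

text \<open>Telescoping works because \<open>(n + 1/2) * (n + 3/2)\<close> is
  \<open>(n + 1)\<^sup>2 - 1/4\<close>, just below the square.\<close>

lemma harm2_diff_le:
  assumes "r \<le> n"
  shows "harm2 n - harm2 r \<le> 1 / (real r + 1 / 2) - 1 / (real n + 1 / 2)"
  using assms
proof (induction n rule: dec_induct)
  case (step n)
  have "1 / (real n + 1)\<^sup>2 \<le> 1 / ((real n + 1 / 2) * (real n + 3 / 2))"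
    by (intro divide_left_mono mult_pos_pos zero_less_power) (auto simp: power2_eq_square algebra_simps)
  also have "\<dots> = 1 / (real n + 1 / 2) - 1 / (real (Suc n) + 1 / 2)"
    by (simp add: field_simps)
  finally show ?case using step by (simp add: harm2_Suc)
qed simp

text \<open>The left side is a variance, \<open>harm r - ln p\<close> being the mean. By the
  previous identities it is the mean of \<open>harm2 n - harm2 r\<close>, to which the telescoping
  bound applies.\<close>

lemma nb_weight_harm_variance_le:
  assumes p: "0 < p" "p < 1"
  shows "(\<Sum>n. nb_weight p r n * (harm n)\<^sup>2) - (harm r - ln p)\<^sup>2
    \<le> (real r + 1) * (1 - p) / ((real r + 1 / 2) * (real r + 1 - p / 2))"
proof -
  define m where "m = (real r + 1) / p - 1 / 2"
  have "(real r + 1) / p \<ge> 1"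
    using p by (simp add: field_simps)
  then have m: "m > 0" unfolding m_def by linarith
  have "(\<lambda>n. nb_weight p r n * (harm n)\<^sup>2) sums (\<Sum>n. nb_weight p r n * (harm n)\<^sup>2)"
    by (intro summable_sums summable_rabs_cancel[OF summable_nb_weight_harm(2)[OF p]])
  from sums_diff[OF this nb_weight_sums_harm_squared[OF p, of r]]
  have "(\<lambda>n. nb_weight p r n * harm2 n) sums
      ((\<Sum>n. nb_weight p r n * (harm n)\<^sup>2) - ((harm r - ln p)\<^sup>2 - harm2 r))"
    by (simp add: algebra_simps)
  from sums_diff[OF this sums_mult2[OF nb_weight_sums_1[OF p], where c = "harm2 r"]]
  have L: "(\<lambda>n. nb_weight p r n * (harm2 n - harm2 r)) sums
      ((\<Sum>n. nb_weight p r n * (harm n)\<^sup>2) - (harm r - ln p)\<^sup>2)"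
    by (simp add: algebra_simps)
  \<comment> \<open>Constant part of the tangent-line bound once \<open>n + 1/2\<close> is written
    as \<open>(n + 1) - 1/2\<close>; only the total mass and the mean of \<open>n + 1\<close> are
    then needed.\<close>
  define c where "c = 1 / (real r + 1 / 2) - 2 / m - 1 / (2 * m\<^sup>2)"
  have "(\<lambda>n. nb_weight p r n * c + nb_weight p r n * (real n + 1) * (1 / m\<^sup>2)) sums
      (1 * c + (real r + 1) / p * (1 / m\<^sup>2))"
    by (intro sums_add sums_mult2 nb_weight_sums_1 nb_weight_sums_real p)
  also have "(\<lambda>n. nb_weight p r n * c + nb_weight p r n * (real n + 1) * (1 / m\<^sup>2))
      = (\<lambda>n. nb_weight p r n * (1 / (real r + 1 / 2) - (2 / m - (real n + 1 / 2) / m\<^sup>2)))"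
    by (simp add: c_def fun_eq_iff algebra_simps add_divide_distrib)
  also have "1 * c + (real r + 1) / p * (1 / m\<^sup>2) = 1 / (real r + 1 / 2) - 1 / m"
  proof -
    have "(real r + 1) / p = m + 1 / 2" by (simp add: m_def)
    then have "(real r + 1) / p * (1 / m\<^sup>2) = 1 / m + 1 / (2 * m\<^sup>2)"
      using m by (simp only:) (simp add: power2_eq_square field_simps)
    then show ?thesis by (simp add: c_def)
  qed
  finally have R: "(\<lambda>n. nb_weight p r n * (1 / (real r + 1 / 2) - (2 / m - (real n + 1 / 2) / m\<^sup>2)))
    sums (1 / (real r + 1 / 2) - 1 / m)" .
  \<comment> \<open>Jensen: \<open>1 / x\<close> lies above its tangent at \<open>m\<close>, the mean of \<open>n + 1 / 2\<close>.\<close>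
  have "(\<Sum>n. nb_weight p r n * (harm n)\<^sup>2) - (harm r - ln p)\<^sup>2 \<le> 1 / (real r + 1 / 2) - 1 / m"
  proof (rule sums_le[OF _ L R])
    fix n
    show "nb_weight p r n * (harm2 n - harm2 r)
        \<le> nb_weight p r n * (1 / (real r + 1 / 2) - (2 / m - (real n + 1 / 2) / m\<^sup>2))"
    proof (cases "r \<le> n")
      case True
      define x where "x = real n + 1 / 2"
      have "x > 0" by (simp add: x_def)
      have "0 \<le> (x - m)\<^sup>2 / (x * m\<^sup>2)"
        using \<open>x > 0\<close> by simp
      also have "\<dots> = 1 / x - (2 / m - x / m\<^sup>2)"
        using \<open>x > 0\<close> m by (simp add: field_simps power2_eq_square)
      finally have "2 / m - x / m\<^sup>2 \<le> 1 / x" by simp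
      with harm2_diff_le[OF True]
      have "harm2 n - harm2 r \<le> 1 / (real r + 1 / 2) - (2 / m - (real n + 1 / 2) / m\<^sup>2)"
        by (simp add: x_def)
      then show ?thesis
        using nb_weight_nonneg[of p r n] p by (intro mult_left_mono) auto
    next
      \<comment> \<open>The telescoping bound requires \<open>r \<le> n\<close>, but below
        \<open>r\<close> the weight vanishes.\<close>
      case False
      then show ?thesis by (simp add: nb_weight_eq_0)
    qed
  qed
  also have "1 / m = p / (real r + 1 - p / 2)"
    using p by (simp add: m_def field_simps)
  also have "1 / (real r + 1 / 2) - p / (real r + 1 - p / 2)
    = (real r + 1) * (1 - p) / ((real r + 1 / 2) * (real r + 1 - p / 2))"
  proof -
    have "real r + 1 - p / 2 > 0" using p by simp
    then show ?thesis by (simp add: divide_simps) algebra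
  qed
  finally show ?thesis .
qed

section \<open>Rational inequalities for the variance bounds\<close>

text \<open>The sum is symmetric under exchanging \<open>p\<close> and \<open>1 - p\<close>, so over
  a common denominator it depends on \<open>p\<close> only through \<open>w\<close>.\<close>

lemma variance_sum_bound:
  fixes r p :: real
  assumes "2 \<le> r" "0 < p" "p < 1"
  defines "w \<equiv> p * (1 - p)"
  shows "r * (1 - p) / ((r - 1 / 2) * (r - p / 2)) + r * p / ((r - 1 / 2) * (r - (1 - p) / 2))
    \<le> (r - w) / (r\<^sup>2 - r + w)"
proof -
  have w: "0 < w" "w \<le> 1 / 4"
  proof -
    show "0 < w" using assms by simp
    have "0 \<le> (p - 1 / 2)\<^sup>2" by simp
    then show "w \<le> 1 / 4" by (simp add: w_def power2_eq_square algebra_simps)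
  qed
  have pos: "r - 1 / 2 > 0" "r - p / 2 > 0" "r - (1 - p) / 2 > 0"
    using assms by auto
  have "r * (1 - p) / ((r - 1 / 2) * (r - p / 2)) + r * p / ((r - 1 / 2) * (r - (1 - p) / 2))
      = r * (r - 1 / 2 + w) / ((r - 1 / 2) * (r\<^sup>2 - r / 2 + w / 4))"
  proof -
    have e: "(r - p / 2) * (r - (1 - p) / 2) = r\<^sup>2 - r / 2 + w / 4"
      by (simp add: w_def power2_eq_square field_simps)
    have "r * (1 - p) / ((r - 1 / 2) * (r - p / 2)) + r * p / ((r - 1 / 2) * (r - (1 - p) / 2))
      = r * ((1 - p) * (r - (1 - p) / 2) + p * (r - p / 2))
          / ((r - 1 / 2) * ((r - p / 2) * (r - (1 - p) / 2)))"
      using pos by (simp add: divide_simps) algebra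
    also have "(1 - p) * (r - (1 - p) / 2) + p * (r - p / 2) = r - 1 / 2 + w"
      by (simp add: w_def field_simps)
    finally show ?thesis by (simp only: e)
  qed
  also have "\<dots> \<le> (r - w) / (r\<^sup>2 - r + w)"
  proof -
    have r2: "r\<^sup>2 \<ge> 2 * r" using assms by (simp add: power2_eq_square)
    have d: "(r - 1 / 2) * (r\<^sup>2 - r / 2 + w / 4) > 0" "r\<^sup>2 - r + w > 0"
      using r2 w assms(1) pos by (auto intro!: mult_pos_pos)
    have "r\<^sup>2 / 4 + r / 8 - w * (5 * r / 4 - 1 / 8) \<ge> 0"
    proof -
      have "w * (5 * r / 4 - 1 / 8) \<le> 1 / 4 * (5 * r / 4 - 1 / 8)"
        using w assms by (intro mult_right_mono) auto
      then show ?thesis using r2 assms(1) by argo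
    qed
    \<comment> \<open>The cross-multiplied difference, grouped so that \<open>w \<le> 1/4\<close>
      makes the first summand nonnegative and the estimate just shown handles the second.\<close>
    then have "0 \<le> (r\<^sup>2 - r / 2) * (r * (1 - 4 * w) / 2) + w * (r\<^sup>2 / 4 + r / 8 - w * (5 * r / 4 - 1 / 8))"
      using w r2 assms by (intro add_nonneg_nonneg mult_nonneg_nonneg) auto
    also have "\<dots> = (r - w) * ((r - 1 / 2) * (r\<^sup>2 - r / 2 + w / 4)) - r * (r - 1 / 2 + w) * (r\<^sup>2 - r + w)"
      by (simp add: power2_eq_square field_simps)
    finally show ?thesis
      using d by (simp add: divide_simps)
  qed
  finally show ?thesis .
qed

text \<open>The subtracted term is at most \<open>w / d\<close>, because
  \<open>d \<le> (r - 1/2)\<^sup>2\<close> when \<open>w \<le> 1/4\<close>. The main fraction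
  exceeds \<open>(r - w) / d + w / d = r / d\<close> by
  \<open>(r/4 - 1/4) / (d * (r - 1/2))\<close>.\<close>

lemma variance_bound_less:
  fixes r w :: real
  assumes r: "2 \<le> r" and w: "0 < w" "w \<le> 1 / 4"
  shows "(r - w) / (r\<^sup>2 - r + w)
    < (r\<^sup>2 - r / 4 - 1 / 4) / ((r\<^sup>2 - r + w) * (r - 1 / 2)) - w / (r - 1 / 2)\<^sup>2 * (1 - 1 / (2 * r - 3))"
proof -
  define d where "d = r\<^sup>2 - r + w"
  have r2: "r\<^sup>2 \<ge> 2 * r" using r by (simp add: power2_eq_square)
  have d: "d > 0" using r2 w r by (simp add: d_def)
  have h: "r - 1 / 2 > 0" using r by simp
  have dh: "d \<le> (r - 1 / 2)\<^sup>2"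
    using w by (simp add: d_def power2_eq_square algebra_simps)
  have "w / (r - 1 / 2)\<^sup>2 * (1 - 1 / (2 * r - 3)) \<le> w / (r - 1 / 2)\<^sup>2 * 1"
    using r w by (intro mult_left_mono) auto
  also have "\<dots> \<le> w / d"
    using d w dh h by (auto intro!: divide_left_mono)
  also have "\<dots> < (r\<^sup>2 - r / 4 - 1 / 4) / (d * (r - 1 / 2)) - (r - w) / d"
  proof -
    have "(r\<^sup>2 - r / 4 - 1 / 4) / (d * (r - 1 / 2)) - (r - w) / d - w / d
        = (r / 4 - 1 / 4) / (d * (r - 1 / 2))"
      using d h by (simp add: divide_simps) (simp add: power2_eq_square algebra_simps)
    also have "\<dots> > 0" using d h r by auto
    finally show ?thesis by simp
  qed
  finally show ?thesis by (simp add: d_def)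
qed

text \<open>Discarding the subtracted term and setting \<open>w = 0\<close> in the denominator only
  enlarges the left side, which leaves an inequality in \<open>r\<close> alone.\<close>

lemma variance_bound_less_simple:
  fixes r w :: real
  assumes r: "2 \<le> r" and w: "0 < w"
  shows "(r\<^sup>2 - r / 4 - 1 / 4) / ((r\<^sup>2 - r + w) * (r - 1 / 2)) - w / (r - 1 / 2)\<^sup>2 * (1 - 1 / (2 * r - 3))
    < 1 / (r - 5 / 4) * (1 - 7 / (4 * r - 1)\<^sup>2)"
proof -
  have r2: "r\<^sup>2 \<ge> 2 * r" using r by (simp add: power2_eq_square)
  have "0 \<le> w / (r - 1 / 2)\<^sup>2 * (1 - 1 / (2 * r - 3))"
    using r w by (intro mult_nonneg_nonneg) auto
  then have "(r\<^sup>2 - r / 4 - 1 / 4) / ((r\<^sup>2 - r + w) * (r - 1 / 2)) - w / (r - 1 / 2)\<^sup>2 * (1 - 1 / (2 * r - 3))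
     \<le> (r\<^sup>2 - r / 4 - 1 / 4) / ((r\<^sup>2 - r + w) * (r - 1 / 2))" by simp
  also have "\<dots> \<le> (r\<^sup>2 - r / 4 - 1 / 4) / ((r\<^sup>2 - r) * (r - 1 / 2))"
    using r w r2 by (intro divide_left_mono mult_right_mono mult_pos_pos) auto
  also have "\<dots> < (4 * (4 * r - 1)\<^sup>2 - 28) / ((4 * r - 5) * (4 * r - 1)\<^sup>2)"
  proof -
    \<comment> \<open>Expanded around \<open>r = 2\<close>, the cross-multiplied difference has only
      positive coefficients.\<close>
    define t where "t = r - 2"
    have t: "t \<ge> 0" "r = t + 2" using r by (auto simp: t_def)
    have d: "(r\<^sup>2 - r) * (r - 1 / 2) > 0" "(4 * r - 5) * (4 * r - 1)\<^sup>2 > 0"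
      using r r2 by (auto intro!: mult_pos_pos)
    have "(4 * (4 * r - 1)\<^sup>2 - 28) * ((r\<^sup>2 - r) * (r - 1 / 2))
        - (r\<^sup>2 - r / 4 - 1 / 4) * ((4 * r - 5) * (4 * r - 1)\<^sup>2) = 8 * t\<^sup>2 + 119 / 4 * t + 105 / 4"
      unfolding t(2) by (simp add: power2_eq_square field_simps)
    also have "\<dots> > 0"
      using t(1) by (simp add: add_nonneg_pos)
    finally show ?thesis using d by (simp add: divide_simps) argo
  qed
  also have "\<dots> = 1 / (r - 5 / 4) * (1 - 7 / (4 * r - 1)\<^sup>2)"
    using r by (simp add: divide_simps)
  finally show ?thesis .
qed

section \<open>The stopping index: counting and measurability\<close>

lemma samples_until_eq_Suc:
  assumes "card {i. i < n \<and> s i} = r" "s n"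
  shows "samples_until (Suc r) s = Suc n"
  unfolding samples_until_def
proof (rule Least_equality)
  have "{i. i < Suc n \<and> s i} = insert n {i. i < n \<and> s i}"
    using assms(2) by (auto simp: less_Suc_eq)
  then show "card {i. i < Suc n \<and> s i} = Suc r"
    using assms(1) by simp
next
  fix m assume m: "card {i. i < m \<and> s i} = Suc r"
  show "Suc n \<le> m"
  proof (rule ccontr)
    assume "\<not> Suc n \<le> m"
    then have "card {i. i < m \<and> s i} \<le> card {i. i < n \<and> s i}"
      by (intro card_mono) auto
    then show False using m assms(1) by simp
  qed
qed

text \<open>As a sum of real indicators, the count becomes accessible to the measurability and
  independence rules for sums.\<close>

lemma card_less_eq_sum:
  fixes n :: nat
  shows "real (card {i. i < n \<and> s i}) = (\<Sum>i<n. of_bool (s i))"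
proof -
  have "{i. i < n \<and> s i} = {..<n} \<inter> {i. s i}" by auto
  then show ?thesis by simp
qed

lemma measurable_samples_until [measurable]:
  "samples_until r \<in> measurable (PiM UNIV (\<lambda>_. count_space UNIV)) (count_space UNIV)"
proof -
  have [measurable]: "(\<lambda>s :: nat \<Rightarrow> bool. s i) \<in> measurable (PiM UNIV (\<lambda>_. count_space UNIV)) (count_space UNIV)" for i
    by (rule measurable_component_singleton) simp
  have "Measurable.pred (PiM UNIV (\<lambda>_. count_space UNIV)) (\<lambda>s :: nat \<Rightarrow> bool. card {i. i < n \<and> s i} = r)" for n
  proof -
    have "(\<lambda>s :: nat \<Rightarrow> bool. card {i. i < n \<and> s i} = r)
        = (\<lambda>s. (\<Sum>i<n. of_bool (s i)) = real r)"
      by (simp add: card_less_eq_sum [symmetric])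
    then show ?thesis by simp
  qed
  then show ?thesis
    unfolding samples_until_def [abs_def] by measurable
qed

section \<open>Distribution and moments of the sample count\<close>

context prob_space
begin

text \<open>The count involves only indices below \<open>n\<close>, so as a sum of indicators it is
  independent of the trial at \<open>n\<close>.\<close>

lemma prob_card_less_indep:
  fixes X :: "nat \<Rightarrow> 'a \<Rightarrow> bool"
  assumes X: "indep_vars (\<lambda>_. count_space UNIV) X UNIV"
  shows "prob {\<omega> \<in> space M. card {i. i < n \<and> X i \<omega>} = k \<and> X n \<omega> = b}
    = prob {\<omega> \<in> space M. card {i. i < n \<and> X i \<omega>} = k} * prob {\<omega> \<in> space M. X n \<omega> = b}"
proof -
  have "indep_vars (\<lambda>_. borel) (\<lambda>i \<omega>. of_bool (X i \<omega>) :: real) (insert n {..<n})"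
    by (rule indep_vars_compose2[OF indep_vars_subset[OF X subset_UNIV]]) simp
  then have "indep_var borel (\<lambda>\<omega>. of_bool (X n \<omega>) :: real) borel (\<lambda>\<omega>. \<Sum>i<n. of_bool (X i \<omega>))"
    by (intro indep_vars_sum) auto
  from indep_varD[OF this, of "{of_bool b}" "{real k}"]
  have "prob {\<omega> \<in> space M. of_bool (X n \<omega>) = (of_bool b :: real) \<and> (\<Sum>i<n. of_bool (X i \<omega>)) = real k}
    = prob {\<omega> \<in> space M. of_bool (X n \<omega>) = (of_bool b :: real)}
      * prob {\<omega> \<in> space M. (\<Sum>i<n. of_bool (X i \<omega>)) = real k}"
    by (simp add: vimage_def Int_def conj_ac)
  then show ?thesis
    by (simp add: card_less_eq_sum [symmetric] of_bool_eq_iff conj_ac mult.commute)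
qed

text \<open>The binomial law, by splitting on the last trial and Pascal's rule.\<close>

lemma prob_card_less:
  fixes X :: "nat \<Rightarrow> 'a \<Rightarrow> bool"
  assumes X: "indep_vars (\<lambda>_. count_space UNIV) X UNIV"
    and p: "\<And>i. prob {\<omega> \<in> space M. X i \<omega>} = p"
  shows "prob {\<omega> \<in> space M. card {i. i < n \<and> X i \<omega>} = k} = real (n choose k) * p ^ k * (1 - p) ^ (n - k)"
proof (induction n arbitrary: k)
  case 0
  show ?case by (cases k) (simp_all add: prob_space)
next
  case (Suc n)
  have [measurable]: "X i \<in> measurable M (count_space UNIV)" for i
    using X by (auto simp: indep_vars_def)
  have [measurable]: "Measurable.pred M (\<lambda>\<omega>. card {i. i < n \<and> X i \<omega>} = k)" for n k
  proof -
    have "(\<lambda>\<omega>. card {i. i < n \<and> X i \<omega>} = k) = (\<lambda>\<omega>. (\<Sum>i<n. of_bool (X i \<omega>)) = real k)"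
      by (simp add: card_less_eq_sum [symmetric])
    then show ?thesis by simp
  qed
  have q: "prob {\<omega> \<in> space M. X i \<omega> = b} = (if b then p else 1 - p)" for i b
    using p[of i] prob_neg[of "X i"] by (cases b) simp_all
  have card_Suc: "card {i. i < Suc n \<and> s i} = card {i. i < n \<and> s i} + of_bool (s n)" for s
  proof -
    have "{i. i < Suc n \<and> s i} = (if s n then insert n {i. i < n \<and> s i} else {i. i < n \<and> s i})"
      by (auto simp: less_Suc_eq)
    then show ?thesis by simp
  qed
  have "prob {\<omega> \<in> space M. card {i. i < Suc n \<and> X i \<omega>} = k}
    = prob ({\<omega> \<in> space M. card {i. i < n \<and> X i \<omega>} = k \<and> X n \<omega> = False}
        \<union> {\<omega> \<in> space M. Suc (card {i. i < n \<and> X i \<omega>}) = k \<and> X n \<omega> = True})"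
    by (intro arg_cong[where f = prob]) (auto simp: card_Suc)
  also have "\<dots> = prob {\<omega> \<in> space M. card {i. i < n \<and> X i \<omega>} = k \<and> X n \<omega> = False}
      + prob {\<omega> \<in> space M. Suc (card {i. i < n \<and> X i \<omega>}) = k \<and> X n \<omega> = True}"
    by (intro finite_measure_Union) auto
  also have "\<dots> = real (Suc n choose k) * p ^ k * (1 - p) ^ (Suc n - k)"
  proof (cases k)
    case 0
    then show ?thesis
      using prob_card_less_indep[OF X, of n 0 False] Suc.IH[of 0] q[of n False]
      by (simp add: 0)
  next
    case (Suc j)
    have "prob {\<omega> \<in> space M. card {i. i < n \<and> X i \<omega>} = Suc j \<and> X n \<omega> = False}
      + prob {\<omega> \<in> space M. card {i. i < n \<and> X i \<omega>} = j \<and> X n \<omega> = True}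
      = real (n choose Suc j) * p ^ Suc j * (1 - p) ^ (n - Suc j) * (1 - p)
        + real (n choose j) * p ^ j * (1 - p) ^ (n - j) * p"
      unfolding prob_card_less_indep[OF X] Suc.IH q by simp
    also have "\<dots> = real (Suc n choose Suc j) * p ^ Suc j * (1 - p) ^ (Suc n - Suc j)"
    proof (cases "j < n")
      case True
      then have e: "n - j = Suc (n - Suc j)" by simp
      show ?thesis
        unfolding diff_Suc_Suc binomial_Suc_Suc of_nat_add e by (simp add: algebra_simps)
    next
      case False
      then show ?thesis by (simp add: binomial_eq_0 algebra_simps)
    qed
    finally show ?thesis using Suc by simp
  qed
  finally show ?case .
qed

text \<open>
  Only \<open>\<le>\<close> is shown here, as the value of \<open>samples_until\<close> is unspecified on sequences with too few hits;
  equality follows because the weights already sum to 1.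
\<close>

lemma prob_samples_until_ge:
  fixes X :: "nat \<Rightarrow> 'a \<Rightarrow> bool"
  assumes X: "indep_vars (\<lambda>_. count_space UNIV) X UNIV"
    and p: "\<And>i. prob {\<omega> \<in> space M. X i \<omega>} = p"
  shows "nb_weight p r n \<le> prob {\<omega> \<in> space M. samples_until (Suc r) (\<lambda>i. X i \<omega>) = Suc n}"
proof -
  have [measurable]: "X i \<in> measurable M (count_space UNIV)" for i
    using X by (auto simp: indep_vars_def)
  have [measurable]: "(\<lambda>\<omega> i. X i \<omega>) \<in> measurable M (PiM UNIV (\<lambda>_. count_space UNIV))"
    by (rule measurable_PiM_single') auto
  have "nb_weight p r n = prob {\<omega> \<in> space M. card {i. i < n \<and> X i \<omega>} = r \<and> X n \<omega> = True}"
    unfolding prob_card_less_indep[OF X] prob_card_less[OF X p] by (simp add: p nb_weight_def)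
  also have "\<dots> \<le> prob {\<omega> \<in> space M. samples_until (Suc r) (\<lambda>i. X i \<omega>) = Suc n}"
    by (intro finite_measure_mono) (auto intro: samples_until_eq_Suc)
  finally show ?thesis .
qed

text \<open>The point masses of \<open>T\<close> dominate \<open>v\<close> and both sum to 1, so
  they agree: the nonnegative differences have sum 0. Expectations then become series.\<close>

lemma expectation_nat_valued:
  fixes T :: "'a \<Rightarrow> nat" and g :: "nat \<Rightarrow> real"
  assumes T [measurable]: "T \<in> measurable M (count_space UNIV)"
    and v: "\<And>k. 0 \<le> v k" "v sums 1" "\<And>k. v k \<le> prob {\<omega> \<in> space M. T \<omega> = k}"
    and g: "summable (\<lambda>k. \<bar>v k * g k\<bar>)"
  shows "integrable M (\<lambda>\<omega>. g (T \<omega>))" "expectation (\<lambda>\<omega>. g (T \<omega>)) = (\<Sum>k. v k * g k)"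
proof -
  define u where "u k = prob {\<omega> \<in> space M. T \<omega> = k}" for k
  have "(\<lambda>k. prob {\<omega> \<in> space M. T \<omega> = k}) sums prob (\<Union>k. {\<omega> \<in> space M. T \<omega> = k})"
    by (intro finite_measure_UNION) (auto simp: disjoint_family_on_def)
  also have "(\<Union>k. {\<omega> \<in> space M. T \<omega> = k}) = space M"
    by auto
  finally have "u sums 1"
    by (simp add: u_def [abs_def] prob_space)
  from sums_diff[OF this v(2)] have "(\<lambda>k. u k - v k) sums 0"
    by simp
  then have "u k - v k = 0" for k
    using v(3) suminf_eq_zero_iff[of "\<lambda>k. u k - v k"] by (auto simp: sums_iff u_def)
  then have u: "prob {\<omega> \<in> space M. T \<omega> = k} = v k" for k
    by (simp add: u_def)
  have D: "distr M (count_space UNIV) T = density (count_space UNIV) v"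
  proof (rule measure_eqI_countable[where A = UNIV])
    fix k
    show "emeasure (distr M (count_space UNIV) T) {k} = emeasure (density (count_space UNIV) v) {k}"
      using u[of k] by (simp add: emeasure_distr emeasure_density emeasure_eq_measure vimage_def Int_def conj_ac)
  qed auto
  have I: "integrable (count_space UNIV) (\<lambda>k. v k * g k)"
    using g by (simp add: integrable_count_space_nat_iff)
  show "integrable M (\<lambda>\<omega>. g (T \<omega>))"
  proof -
    have "integrable (distr M (count_space UNIV) T) g"
      unfolding D using v I by (subst integrable_density) auto
    then show ?thesis by (subst (asm) integrable_distr_eq) auto
  qed
  have "expectation (\<lambda>\<omega>. g (T \<omega>)) = integral\<^sup>L (distr M (count_space UNIV) T) g"
    by (subst integral_distr) auto
  also have "\<dots> = (\<Sum>k. v k * g k)"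
    unfolding D using v I by (subst integral_density) (auto simp: integral_count_space_nat)
  finally show "expectation (\<lambda>\<omega>. g (T \<omega>)) = (\<Sum>k. v k * g k)" .
qed

lemma expectation_samples_until:
  fixes X :: "nat \<Rightarrow> 'a \<Rightarrow> bool" and g :: "nat \<Rightarrow> real"
  assumes X: "indep_vars (\<lambda>_. count_space UNIV) X UNIV"
    and p: "\<And>i. prob {\<omega> \<in> space M. X i \<omega>} = p" "0 < p" "p < 1"
    and g: "summable (\<lambda>n. \<bar>nb_weight p r n * g (Suc n)\<bar>)"
  defines "T \<equiv> \<lambda>\<omega>. samples_until (Suc r) (\<lambda>i. X i \<omega>)"
  shows "integrable M (\<lambda>\<omega>. g (T \<omega>))"
    and "expectation (\<lambda>\<omega>. g (T \<omega>)) = (\<Sum>n. nb_weight p r n * g (Suc n))"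
proof -
  \<comment> \<open>Shifts the weights to the law of \<open>T\<close>: hit number
    \<open>r + 1\<close> at index \<open>n\<close> gives the value \<open>Suc n\<close>, and the
    value 0 gets mass 0.\<close>
  define v where "v = case_nat 0 (nb_weight p r)"
  have [measurable]: "X i \<in> measurable M (count_space UNIV)" for i
    using X by (auto simp: indep_vars_def)
  have [measurable]: "(\<lambda>\<omega> i. X i \<omega>) \<in> measurable M (PiM UNIV (\<lambda>_. count_space UNIV))"
    by (rule measurable_PiM_single') auto
  have T: "T \<in> measurable M (count_space UNIV)"
    unfolding T_def by measurable
  have 1: "0 \<le> v k" for k
    using p by (auto simp: v_def nb_weight_nonneg split: nat.split)
  have 2: "v sums 1"
    using nb_weight_sums_1[OF p(2,3), of r] sums_Suc_iff[of v 1] by (simp add: v_def)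
  have 3: "v k \<le> prob {\<omega> \<in> space M. T \<omega> = k}" for k
    using prob_samples_until_ge[OF X p(1), of r] by (auto simp: v_def T_def split: nat.split)
  have 4: "summable (\<lambda>k. \<bar>v k * g k\<bar>)"
    using g summable_Suc_iff[of "\<lambda>k. \<bar>v k * g k\<bar>"] by (simp add: v_def)
  note * = expectation_nat_valued[OF T 1 2 3 4]
  show "integrable M (\<lambda>\<omega>. g (T \<omega>))" by (rule *)
  have "(\<Sum>k. v k * g k) = (\<Sum>n. v (Suc n) * g (Suc n))"
    using suminf_split_head[OF summable_rabs_cancel[OF 4]] by (simp add: v_def)
  with * show "expectation (\<lambda>\<omega>. g (T \<omega>)) = (\<Sum>n. nb_weight p r n * g (Suc n))"
    by (simp add: v_def)
qed

lemma samples_until_moments: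
  fixes X :: "nat \<Rightarrow> 'a \<Rightarrow> bool"
  assumes X: "indep_vars (\<lambda>_. count_space UNIV) X UNIV"
    and p: "\<And>i. prob {\<omega> \<in> space M. X i \<omega>} = p" "0 < p" "p < 1"
    and r: "0 < r"
  defines "T \<equiv> \<lambda>\<omega>. samples_until r (\<lambda>i. X i \<omega>)"
  shows "integrable M (\<lambda>\<omega>. real (T \<omega>))" "expectation (\<lambda>\<omega>. real (T \<omega>)) = real r / p"
    and "integrable M (\<lambda>\<omega>. harm (T \<omega> - 1) :: real)"
        "expectation (\<lambda>\<omega>. harm (T \<omega> - 1)) = harm (r - 1) - ln p"
    and "integrable M (\<lambda>\<omega>. (harm (T \<omega> - 1) :: real)\<^sup>2)"
        "variance (\<lambda>\<omega>. harm (T \<omega> - 1)) \<le> real r * (1 - p) / ((real r - 1 / 2) * (real r - p / 2))"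
proof -
  obtain r' where r': "r = Suc r'" using r by (cases r) auto
  have E: "integrable M (\<lambda>\<omega>. g (T \<omega>))"
      "expectation (\<lambda>\<omega>. g (T \<omega>)) = (\<Sum>n. nb_weight p r' n * g (Suc n))"
    if "summable (\<lambda>n. \<bar>nb_weight p r' n * g (Suc n)\<bar>)" for g :: "nat \<Rightarrow> real"
    unfolding T_def r' using that by (rule expectation_samples_until[OF X p])+
  have s: "summable (\<lambda>n. \<bar>nb_weight p r' n * real (Suc n)\<bar>)"
    by (rule summable_nb_weight(1)[OF p(2,3), of _ 1]) simp
  show "integrable M (\<lambda>\<omega>. real (T \<omega>))" by (rule E(1)[of real, OF s])
  show "expectation (\<lambda>\<omega>. real (T \<omega>)) = real r / p"
    unfolding E(2)[of real, OF s] using sums_unique[OF nb_weight_sums_real[OF p(2,3), of r']]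
    by (simp add: r' add.commute)
  note H = summable_nb_weight_harm[OF p(2,3), of r']
  show 1: "integrable M (\<lambda>\<omega>. harm (T \<omega> - 1) :: real)"
    using E(1)[of "\<lambda>k. harm (k - 1)"] H(1) by simp
  show 2: "expectation (\<lambda>\<omega>. harm (T \<omega> - 1)) = harm (r - 1) - ln p"
    using E(2)[of "\<lambda>k. harm (k - 1)"] H(1) sums_unique[OF nb_weight_sums_harm[OF p(2,3), of r']]
    by (simp add: r')
  show 3: "integrable M (\<lambda>\<omega>. (harm (T \<omega> - 1) :: real)\<^sup>2)"
    using E(1)[of "\<lambda>k. (harm (k - 1))\<^sup>2"] H(2) by simp
  have "expectation (\<lambda>\<omega>. (harm (T \<omega> - 1))\<^sup>2) = (\<Sum>n. nb_weight p r' n * (harm n)\<^sup>2)"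
    using E(2)[of "\<lambda>k. (harm (k - 1))\<^sup>2"] H(2) by simp
  then have "variance (\<lambda>\<omega>. harm (T \<omega> - 1))
      = (\<Sum>n. nb_weight p r' n * (harm n)\<^sup>2) - (harm r' - ln p)\<^sup>2"
    using variance_eq[OF 1 3] 2 r' by simp
  also note nb_weight_harm_variance_le[OF p(2,3), of r']
  finally have "variance (\<lambda>\<omega>. harm (T \<omega> - 1))
      \<le> (real r' + 1) * (1 - p) / ((real r' + 1 / 2) * (real r' + 1 - p / 2))" .
  moreover have "real r' + 1 = real r" "real r' + 1 / 2 = real r - 1 / 2"
    by (simp_all add: r')
  ultimately show "variance (\<lambda>\<omega>. harm (T \<omega> - 1)) \<le> real r * (1 - p) / ((real r - 1 / 2) * (real r - p / 2))"
    by simp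
qed

section \<open>Combining the two independent counts\<close>

lemma indep_variance_diff:
  fixes A B :: "'a \<Rightarrow> real"
  assumes AB: "indep_var borel A borel B"
    and A: "integrable M A" "integrable M (\<lambda>\<omega>. (A \<omega>)\<^sup>2)"
    and B: "integrable M B" "integrable M (\<lambda>\<omega>. (B \<omega>)\<^sup>2)"
  shows "integrable M (\<lambda>\<omega>. (- A \<omega> + B \<omega>)\<^sup>2)"
    and "variance (\<lambda>\<omega>. - A \<omega> + B \<omega>) = variance A + variance B"
proof -
  have e: "(\<lambda>\<omega>. (- A \<omega> + B \<omega>)\<^sup>2) = (\<lambda>\<omega>. (A \<omega>)\<^sup>2 + (B \<omega>)\<^sup>2 - 2 * (A \<omega> * B \<omega>))"
    by (simp add: power2_eq_square algebra_simps)
  note I = indep_var_integrable[OF AB A(1) B(1)]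
  show I2: "integrable M (\<lambda>\<omega>. (- A \<omega> + B \<omega>)\<^sup>2)"
    unfolding e using A B I by simp
  have E2: "expectation (\<lambda>\<omega>. (- A \<omega> + B \<omega>)\<^sup>2)
      = expectation (\<lambda>\<omega>. (A \<omega>)\<^sup>2) + expectation (\<lambda>\<omega>. (B \<omega>)\<^sup>2) - 2 * (expectation A * expectation B)"
    unfolding e using A B I indep_var_lebesgue_integral[OF AB A(1) B(1)] by simp
  have I1: "integrable M (\<lambda>\<omega>. - A \<omega> + B \<omega>)"
    and E1: "expectation (\<lambda>\<omega>. - A \<omega> + B \<omega>) = - expectation A + expectation B"
    using A B by simp_all
  have "variance (\<lambda>\<omega>. - A \<omega> + B \<omega>)
      = expectation (\<lambda>\<omega>. (- A \<omega> + B \<omega>)\<^sup>2) - (expectation (\<lambda>\<omega>. - A \<omega> + B \<omega>))\<^sup>2"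
    by (rule variance_eq[OF I1 I2])
  also have "\<dots> = (expectation (\<lambda>\<omega>. (A \<omega>)\<^sup>2) - (expectation A)\<^sup>2)
      + (expectation (\<lambda>\<omega>. (B \<omega>)\<^sup>2) - (expectation B)\<^sup>2)"
    unfolding E1 E2 by (simp add: power2_diff)
  finally show "variance (\<lambda>\<omega>. - A \<omega> + B \<omega>) = variance A + variance B"
    by (simp only: variance_eq[OF A] variance_eq[OF B])
qed

end

theorem theorem3:
  fixes M :: "'a measure"
    and X Y :: "nat \<Rightarrow> 'a \<Rightarrow> bool"
    and p :: real and r :: nat
    and N1 N2 :: "'a \<Rightarrow> nat"
    and \<phi> N :: "'a \<Rightarrow> real"
  assumes "prob_space M"
    and "2 \<le> r" and "0 < p" and "p < 1"
    and "prob_space.indep_vars M (\<lambda>_. count_space UNIV) X UNIV"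
    and "\<And>i. distr M (count_space UNIV) (X i) = measure_pmf (bernoulli_pmf p)"
    and "prob_space.indep_vars M (\<lambda>_. count_space UNIV) Y UNIV"
    and "\<And>i. distr M (count_space UNIV) (Y i) = measure_pmf (bernoulli_pmf p)"
    and "prob_space.indep_var M
           (PiM UNIV (\<lambda>_. count_space UNIV)) (\<lambda>\<omega> i. X i \<omega>)
           (PiM UNIV (\<lambda>_. count_space UNIV)) (\<lambda>\<omega> i. Y i \<omega>)"
  defines "N1 \<equiv> \<lambda>\<omega>. samples_until r (\<lambda>i. X i \<omega>)"
    and "N2 \<equiv> \<lambda>\<omega>. samples_until r (\<lambda>i. \<not> Y i \<omega>)"
    and "\<phi> \<equiv> \<lambda>\<omega>. - harm (N1 \<omega> - 1) + harm (N2 \<omega> - 1)"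
    and "N \<equiv> \<lambda>\<omega>. real (N1 \<omega> + N2 \<omega>)"
  shows "(integrable M \<phi> \<and> prob_space.expectation M \<phi> = ln (p / (1 - p)))
     \<and> (integrable M (\<lambda>\<omega>. (\<phi> \<omega>)\<^sup>2)
        \<and> prob_space.variance M \<phi>
            < ((real r)\<^sup>2 - real r / 4 - 1 / 4) / ((real r - 1 + p) * (real r - p) * (real r - 1 / 2))
              - p * (1 - p) / (real r - 1 / 2)\<^sup>2 * (1 - 1 / (2 * real r - 3))
        \<and> ((real r)\<^sup>2 - real r / 4 - 1 / 4) / ((real r - 1 + p) * (real r - p) * (real r - 1 / 2))
              - p * (1 - p) / (real r - 1 / 2)\<^sup>2 * (1 - 1 / (2 * real r - 3))
            < 1 / (real r - 5 / 4) * (1 - 7 / (4 * real r - 1)\<^sup>2))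
     \<and> (integrable M N \<and> prob_space.expectation M N = real r / (p * (1 - p)))"
proof -
  interpret prob_space M by fact
  note p = \<open>0 < p\<close> \<open>p < 1\<close>
  have prob: "prob {\<omega> \<in> space M. Z i \<omega> = b} = (if b then p else 1 - p)"
    if "indep_vars (\<lambda>_. count_space UNIV) Z UNIV"
      and d: "\<And>i. distr M (count_space UNIV) (Z i) = measure_pmf (bernoulli_pmf p)"
    for Z :: "nat \<Rightarrow> 'a \<Rightarrow> bool" and i b
  proof -
    have Z [measurable]: "Z i \<in> measurable M (count_space UNIV)" for i
      using that by (auto simp: indep_vars_def)
    have "prob {\<omega> \<in> space M. Z i \<omega> = b} = measure (distr M (count_space UNIV) (Z i)) {b}"
      by (simp add: measure_distr vimage_def Int_def conj_ac)
    also have "\<dots> = pmf (bernoulli_pmf p) b"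
      by (simp add: d pmf.rep_eq)
    finally show ?thesis using p by simp
  qed
  \<comment> \<open>Failures of \<open>Y\<close> are successes of the negated sequence, so the
    single-count results apply with \<open>1 - p\<close> in place of \<open>p\<close>.\<close>
  have Y': "indep_vars (\<lambda>_. count_space UNIV) (\<lambda>i \<omega>. \<not> Y i \<omega>) UNIV"
    using assms(7) by (rule indep_vars_compose2) simp
  have r: "0 < r" using assms by simp
  have p1: "prob {\<omega> \<in> space M. X i \<omega>} = p" for i
    using prob[OF assms(5,6), of i True] by simp
  have p2: "prob {\<omega> \<in> space M. \<not> Y i \<omega>} = 1 - p" for i
    using prob[OF assms(7,8), of i False] by simp
  note mX = samples_until_moments[OF assms(5) p1 p r]
  note mY = samples_until_moments[OF Y' p2 _ _ r]
  have q: "0 < 1 - p" "1 - p < 1" using p by auto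
  note mY = mY[OF q]
  \<comment> \<open>Each harmonic term is a measurable function of one whole sequence, so it
    inherits the independence of the two sequences.\<close>
  have "indep_var borel ((\<lambda>s. harm (samples_until r s - 1) :: real) \<circ> (\<lambda>\<omega> i. X i \<omega>))
      borel ((\<lambda>s. harm (samples_until r (\<lambda>i. \<not> s i) - 1) :: real) \<circ> (\<lambda>\<omega> i. Y i \<omega>))"
  proof (rule indep_var_compose[OF assms(9)])
    have [measurable]: "(\<lambda>k. harm (k - 1) :: real) \<in> borel_measurable (count_space (UNIV :: nat set))"
      by simp
    have "(\<lambda>s i. \<not> s i) \<in> measurable (PiM UNIV (\<lambda>_ :: nat. count_space UNIV)) (PiM UNIV (\<lambda>_. count_space UNIV))"
    proof (rule measurable_PiM_single')
      show "(\<lambda>s :: nat \<Rightarrow> bool. \<not> s i) \<in> measurable (PiM UNIV (\<lambda>_. count_space UNIV)) (count_space UNIV)" for i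
        by (rule measurable_compose[OF measurable_component_singleton]) auto
    qed auto
    note [measurable] = this
    show "(\<lambda>s. harm (samples_until r s - 1) :: real) \<in> borel_measurable (PiM UNIV (\<lambda>_. count_space UNIV))"
      by measurable
    show "(\<lambda>s. harm (samples_until r (\<lambda>i. \<not> s i) - 1) :: real) \<in> borel_measurable (PiM UNIV (\<lambda>_. count_space UNIV))"
      by measurable
  qed
  then have "indep_var borel (\<lambda>\<omega>. harm (samples_until r (\<lambda>i. X i \<omega>) - 1) :: real)
      borel (\<lambda>\<omega>. harm (samples_until r (\<lambda>i. \<not> Y i \<omega>) - 1))"
    by (simp add: comp_def)
  note V = indep_variance_diff[OF this mX(3,5) mY(3,5)]
  define w where "w = p * (1 - p)"
  have "0 \<le> (p - 1 / 2)\<^sup>2" by simp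
  then have w: "0 < w" "w \<le> 1 / 4"
    using p by (simp_all add: w_def power2_eq_square algebra_simps)
  have r2: "2 \<le> real r" using assms by simp
  have e: "(real r - 1 + p) * (real r - p) = (real r)\<^sup>2 - real r + w"
    by (simp add: w_def power2_eq_square algebra_simps)
  have \<phi>: "\<phi> = (\<lambda>\<omega>. - harm (samples_until r (\<lambda>i. X i \<omega>) - 1) + harm (samples_until r (\<lambda>i. \<not> Y i \<omega>) - 1))"
    by (simp add: \<phi>_def N1_def N2_def)
  have "variance \<phi> \<le> (real r - w) / ((real r)\<^sup>2 - real r + w)"
    unfolding \<phi> using V(2) mX(6) mY(6) variance_sum_bound[OF r2 p] by (simp add: w_def)
  also note variance_bound_less[OF r2 w]
  finally have "variance \<phi> < ((real r)\<^sup>2 - real r / 4 - 1 / 4) / ((real r - 1 + p) * (real r - p) * (real r - 1 / 2))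
              - p * (1 - p) / (real r - 1 / 2)\<^sup>2 * (1 - 1 / (2 * real r - 3))"
    unfolding e w_def .
  moreover have "((real r)\<^sup>2 - real r / 4 - 1 / 4) / ((real r - 1 + p) * (real r - p) * (real r - 1 / 2))
              - p * (1 - p) / (real r - 1 / 2)\<^sup>2 * (1 - 1 / (2 * real r - 3))
            < 1 / (real r - 5 / 4) * (1 - 7 / (4 * real r - 1)\<^sup>2)"
    using variance_bound_less_simple[OF r2 w(1)] unfolding e w_def .
  \<comment> \<open>The terms \<open>harm (r - 1)\<close> cancel, leaving
    \<open>ln p - ln (1 - p)\<close>.\<close>
  moreover have "integrable M \<phi>" "expectation \<phi> = ln (p / (1 - p))"
    unfolding \<phi> using mX(3,4) mY(3,4) p by (simp_all add: ln_div)
  moreover have "integrable M N" "expectation N = real r / p + real r / (1 - p)"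
    unfolding N_def N1_def N2_def of_nat_add using mX(1,2) mY(1,2) by simp_all
  moreover have "real r / p + real r / (1 - p) = real r / (p * (1 - p))"
    using p by (simp add: field_simps)
  moreover have "integrable M (\<lambda>\<omega>. (\<phi> \<omega>)\<^sup>2)"
    unfolding \<phi> by (rule V(1))
  ultimately show ?thesis by simp
qed

end
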